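(* Let $m,n>0$, let $f$ and $g$ be concave positive real functions on $[0,m]$ and $[0,n]$ respectively, and let $A=\{(x,y): 0\le x\le m,\ 0\le y\le f(x)\}$ and $B=\{(x,y): 0\le x\le n,\ 0\le y\le g(x)\}$. If $C=m\left(\frac{|A|}{m^2}-\frac{|B|}{n^2}\right)\ge 0$ and $f(x)=\frac{m}{n}g(\frac{n}{m}x)+C$ for all $x\in[0,m]$, then $$|A+B|=\left(\frac{|A|}{m}+\frac{|B|}{n}\right)(m+n).$$
   Context: $|X|$ denotes area; $A+B$ is the Minkowski sum. *)

theory Defs
  imports "HOL-Analysis.Analysis"
begin

definition minkowski_sum :: "(real \<times> real) set \<Rightarrow> (real \<times> real) set \<Rightarrow> (real \<times> real) set" where
  "minkowski_sum A B = {a + b | a b. a \<in> A \<and> b \<in> B}"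

definition area :: "(real \<times> real) set \<Rightarrow> real" where
  "area X = measure lebesgue X"

end

theory Submission
  imports Defs
begin

text \<open>
  Put \<open>t = m / n\<close> and \<open>S = {0} \<times> [0, C]\<close>. The hypothesis on \<open>f\<close> says exactly that
  \<open>A = t B + S\<close>, and since \<open>B\<close> is convex, \<open>t B + B = (1 + t) B\<close>; hence \<open>A + B = (1 + t) B + S\<close>.
  Adding \<open>S\<close> to the region under a nonnegative graph over \<open>[0, a]\<close> lifts the graph by \<open>C\<close>,
  i.e. adds a rectangle of area \<open>a C\<close>. So \<open>|A| = t\<^sup>2 |B| + t n C\<close> and
  \<open>|A + B| = (1 + t)\<^sup>2 |B| + (1 + t) n C\<close>, and the claim is an identity between these.
\<close>

definition region_under :: "real \<Rightarrow> (real \<Rightarrow> real) \<Rightarrow> (real \<times> real) set" where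
  "region_under a h = {(x, y). 0 \<le> x \<and> x \<le> a \<and> 0 \<le> y \<and> y \<le> h x}"

lemma minkowski_sum_eq_set_plus: "minkowski_sum A B = A + B"
  unfolding minkowski_sum_def set_plus_def by blast

lemma scaleR_plus_scaleR_convex:
  fixes K :: "'a::real_vector set"
  assumes "convex K" "s \<ge> 0" "t \<ge> 0"
  shows "(*\<^sub>R) s ` K + (*\<^sub>R) t ` K = (*\<^sub>R) (s + t) ` K"
proof
  show "(*\<^sub>R) s ` K + (*\<^sub>R) t ` K \<subseteq> (*\<^sub>R) (s + t) ` K"
  proof (clarsimp simp: set_plus_def)
    fix p q assume "p \<in> K" "q \<in> K"
    show "s *\<^sub>R p + t *\<^sub>R q \<in> (*\<^sub>R) (s + t) ` K"
    proof (cases "s + t = 0")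
      case True
      with assms have "s = 0" "t = 0" by auto
      with \<open>p \<in> K\<close> show ?thesis by (auto intro: image_eqI[of _ _ p])
    next
      case False
      define r where "r = (s / (s + t)) *\<^sub>R p + (t / (s + t)) *\<^sub>R q"
      have "r \<in> K"
        unfolding r_def using assms \<open>p \<in> K\<close> \<open>q \<in> K\<close> False
        by (intro convexD) (auto simp: add_divide_distrib[symmetric])
      moreover have "s *\<^sub>R p + t *\<^sub>R q = (s + t) *\<^sub>R r"
        using False by (simp add: r_def scaleR_add_right)
      ultimately show ?thesis by blast
    qed
  qed
  show "(*\<^sub>R) (s + t) ` K \<subseteq> (*\<^sub>R) s ` K + (*\<^sub>R) t ` K"
    by (auto simp: set_plus_def scaleR_add_left)
qed

lemma convex_region_under:
  assumes "concave_on {0..a} h"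
  shows "convex (region_under a h)"
  unfolding convex_alt
proof (intro ballI allI impI)
  fix p q :: "real \<times> real" and u :: real
  assume "p \<in> region_under a h" "q \<in> region_under a h" and u: "0 \<le> u \<and> u \<le> 1"
  then obtain x1 y1 x2 y2 where pq: "p = (x1, y1)" "q = (x2, y2)"
    and p: "0 \<le> x1" "x1 \<le> a" "0 \<le> y1" "y1 \<le> h x1"
    and q: "0 \<le> x2" "x2 \<le> a" "0 \<le> y2" "y2 \<le> h x2"
    by (auto simp: region_under_def)
  have "(1 - u) * y1 + u * y2 \<le> (1 - u) * h x1 + u * h x2"
    using u p q by (intro add_mono mult_left_mono) auto
  also have "\<dots> \<le> h ((1 - u) * x1 + u * x2)"
    using concave_onD[OF assms, of u x1 x2] u p q by auto
  finally have "(1 - u) * y1 + u * y2 \<le> h ((1 - u) * x1 + u * x2)" .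
  moreover have "(1 - u) * x1 + u * x2 \<le> (1 - u) * a + u * a"
    using u p q by (intro add_mono mult_left_mono) auto
  moreover have "0 \<le> (1 - u) * x1 + u * x2" "0 \<le> (1 - u) * y1 + u * y2"
    using u p q by simp_all
  ultimately show "(1 - u) *\<^sub>R p + u *\<^sub>R q \<in> region_under a h"
    by (simp add: pq region_under_def algebra_simps)
qed

lemma bounded_region_under:
  assumes "concave_on {0..a} h" "\<And>x. x \<in> {0..a} \<Longrightarrow> h x \<ge> 0"
  shows "bounded (region_under a h)"
proof -
  have "region_under a h \<subseteq> cbox (0, 0) (a, 2 * h (a / 2))"
  proof (clarsimp simp: region_under_def cbox_Pair_iff)
    fix x y assume xy: "0 \<le> x" "x \<le> a" "0 \<le> y" "y \<le> h x"
    have mid: "(1 - 1 / 2) *\<^sub>R x + (1 / 2) *\<^sub>R (a - x) = a / 2"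
      by (simp add: field_simps)
    have "(1 - 1 / 2) * h x + (1 / 2) * h (a - x) \<le> h (a / 2)"
      using concave_onD[OF assms(1), of "1 / 2" x "a - x"] xy unfolding mid by simp
    then have "h x + h (a - x) \<le> 2 * h (a / 2)" by simp
    moreover have "h (a - x) \<ge> 0" using assms(2) xy by auto
    ultimately show "y \<le> 2 * h (a / 2)" using xy by simp
  qed
  then show ?thesis using bounded_cbox bounded_subset by blast
qed

lemma scaleR_region_under:
  assumes "s > 0"
  shows "(*\<^sub>R) s ` region_under a h = region_under (s * a) (\<lambda>x. s * h (x / s))"
proof (intro equalityI subsetI)
  fix p assume "p \<in> (*\<^sub>R) s ` region_under a h"
  then show "p \<in> region_under (s * a) (\<lambda>x. s * h (x / s))"
    using assms by (auto simp: region_under_def)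
next
  fix p assume "p \<in> region_under (s * a) (\<lambda>x. s * h (x / s))"
  then obtain x y where "p = (x, y)" "0 \<le> x" "x \<le> s * a" "0 \<le> y" "y \<le> s * h (x / s)"
    by (auto simp: region_under_def)
  moreover from this assms have "(x / s, y / s) \<in> region_under a h"
    by (auto simp: region_under_def field_simps)
  ultimately show "p \<in> (*\<^sub>R) s ` region_under a h"
    using assms by (auto intro: image_eqI[of _ _ "(x / s, y / s)"])
qed

lemma region_under_add_const:
  assumes "C \<ge> 0" "\<And>x. x \<in> {0..a} \<Longrightarrow> h x \<ge> 0"
  shows "region_under a (\<lambda>x. h x + C) = region_under a h + {0} \<times> {0..C}"
proof (intro equalityI subsetI)
  fix p assume "p \<in> region_under a (\<lambda>x. h x + C)"
  then obtain x y where xy: "p = (x, y)" "0 \<le> x" "x \<le> a" "0 \<le> y" "y \<le> h x + C"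
    by (auto simp: region_under_def)
  define c where "c = max 0 (y - h x)"
  have "(x, y - c) \<in> region_under a h" "(0, c) \<in> {0::real} \<times> {0..C}"
    using xy assms by (auto simp: region_under_def c_def)
  moreover have "p = (x, y - c) + (0, c)" using xy by simp
  ultimately show "p \<in> region_under a h + {0} \<times> {0..C}" by blast
next
  fix p assume "p \<in> region_under a h + {0} \<times> {0..C}"
  then show "p \<in> region_under a (\<lambda>x. h x + C)"
    using assms by (force simp: region_under_def set_plus_def)
qed

lemma region_under_scaled_add_const:
  assumes "s > 0" "C \<ge> 0" "\<And>x. x \<in> {0..a} \<Longrightarrow> h x \<ge> 0"
  shows "region_under (s * a) (\<lambda>x. s * h (x / s) + C)
    = (*\<^sub>R) s ` region_under a h + {0} \<times> {0..C}"
proof -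
  have "\<And>x. x \<in> {0..s * a} \<Longrightarrow> s * h (x / s) \<ge> 0"
    using assms(1,3) by (simp add: field_simps)
  then show ?thesis
    unfolding scaleR_region_under[OF assms(1)] by (rule region_under_add_const[OF assms(2)])
qed

lemma measure_region_under_plus_segment:
  assumes "a \<ge> 0" "C \<ge> 0" "\<And>x. x \<in> {0..a} \<Longrightarrow> h x \<ge> 0"
    and K: "region_under a h \<in> lmeasurable"
  shows "measure lebesgue (region_under a h + {0} \<times> {0..C})
    = measure lebesgue (region_under a h) + a * C"
proof -
  define T where "T = (+) (0, C) ` region_under a h"
  define R where "R = cbox (0, 0) (a, C)"
  have decomp: "region_under a h + {0} \<times> {0..C} = T \<union> R"
  proof (intro equalityI subsetI)
    fix p assume "p \<in> region_under a h + {0} \<times> {0..C}"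
    then obtain x y c where p: "p = (x, y + c)" and "(x, y) \<in> region_under a h" "0 \<le> c" "c \<le> C"
      by (auto simp: set_plus_def)
    then have xy: "0 \<le> x" "x \<le> a" "0 \<le> y" "y \<le> h x" "0 \<le> c" "c \<le> C"
      by (auto simp: region_under_def)
    show "p \<in> T \<union> R"
    proof (cases "y + c \<le> C")
      case True
      then show ?thesis using p xy by (simp add: R_def cbox_Pair_iff)
    next
      case False
      then have "(x, y + c - C) \<in> region_under a h" using xy by (simp add: region_under_def)
      moreover have "p = (0, C) + (x, y + c - C)" using p by simp
      ultimately show ?thesis unfolding T_def by blast
    qed
  next
    fix p assume "p \<in> T \<union> R"
    then show "p \<in> region_under a h + {0} \<times> {0..C}"
    proof
      assume "p \<in> T"
      then obtain q where "q \<in> region_under a h" "p = q + (0, C)" by (auto simp: T_def)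
      then show ?thesis using assms(2) by auto
    next
      assume "p \<in> R"
      then obtain x c where p: "p = (x, 0) + (0, c)" and "0 \<le> x" "x \<le> a" "0 \<le> c" "c \<le> C"
        by (cases p) (auto simp: R_def cbox_Pair_iff)
      then have "(x, 0) \<in> region_under a h" "(0, c) \<in> {0::real} \<times> {0..C}"
        using assms(3) by (simp_all add: region_under_def)
      then have "(x, 0) + (0, c) \<in> region_under a h + {0} \<times> {0..C}"
        by (rule set_plus_intro)
      then show ?thesis unfolding p .
    qed
  qed
  have "negligible (cbox (0, C) (a, C))"
    by (auto simp: negligible_interval box_eq_empty Basis_prod_def)
  moreover
  \<comment> \<open>The translated region and the rectangle meet only on the segment \<open>[0,a] \<times> {C}\<close>.\<close>
  have "T \<inter> R \<subseteq> cbox (0, C) (a, C)"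
    by (auto simp: T_def R_def region_under_def cbox_Pair_iff)
  ultimately have "measure lebesgue (T \<inter> R) = 0"
    by (rule negligible_imp_measure0[OF negligible_subset])
  moreover have "T \<in> lmeasurable" "R \<in> lmeasurable"
    using K by (simp_all add: T_def R_def measurable_translation)
  ultimately have "measure lebesgue (T \<union> R) = measure lebesgue T + measure lebesgue R"
    by (simp add: measure_Un3)
  also have "\<dots> = measure lebesgue (region_under a h) + a * C"
    using assms(1,2) by (simp add: T_def R_def measure_translation content_Pair)
  finally show ?thesis unfolding decomp .
qed

lemma measure_scaled_region_under_plus_segment:
  assumes "s > 0" "a \<ge> 0" "C \<ge> 0"
    and h: "concave_on {0..a} h" "\<And>x. x \<in> {0..a} \<Longrightarrow> h x \<ge> 0"
  shows "measure lebesgue ((*\<^sub>R) s ` region_under a h + {0} \<times> {0..C})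
    = s\<^sup>2 * measure lebesgue (region_under a h) + s * a * C"
proof -
  have scaled: "(*\<^sub>R) s ` region_under a h = region_under (s * a) (\<lambda>x. s * h (x / s))"
    using assms(1) by (rule scaleR_region_under)
  have "(*\<^sub>R) s ` region_under a h \<in> lmeasurable"
    using h by (intro measurable_convex convex_scaling bounded_scaling
        convex_region_under bounded_region_under)
  moreover have "\<And>x. x \<in> {0..s * a} \<Longrightarrow> s * h (x / s) \<ge> 0"
    using assms(1) h(2) by (simp add: field_simps)
  moreover have "measure lebesgue ((*\<^sub>R) s ` region_under a h)
      = s\<^sup>2 * measure lebesgue (region_under a h)"
    using measure_lebesgue_affine[of s 0 "region_under a h"] assms(1)
    by (simp add: power2_eq_square)
  ultimately show ?thesis
    using measure_region_under_plus_segment[of "s * a" C] assms(1-3)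
    unfolding scaled by simp
qed

theorem lemma4p4:
  fixes m n :: real and f g :: "real \<Rightarrow> real" and A B :: "(real \<times> real) set" and C :: real
  assumes "m > 0" and "n > 0"
    and "concave_on {0..m} f" and "\<And>x. x \<in> {0..m} \<Longrightarrow> f x > 0"
    and "concave_on {0..n} g" and "\<And>x. x \<in> {0..n} \<Longrightarrow> g x > 0"
    and "A = {(x, y). 0 \<le> x \<and> x \<le> m \<and> 0 \<le> y \<and> y \<le> f x}"
    and "B = {(x, y). 0 \<le> x \<and> x \<le> n \<and> 0 \<le> y \<and> y \<le> g x}"
    and "C = m * (area A / m\<^sup>2 - area B / n\<^sup>2)" and "C \<ge> 0"
    and "\<And>x. x \<in> {0..m} \<Longrightarrow> f x = (m / n) * g ((n / m) * x) + C"
  shows "area (minkowski_sum A B) = (area A / m + area B / n) * (m + n)"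
proof -
  define t where "t = m / n"
  have t: "t > 0" "t * n = m" using assms(1,2) by (simp_all add: t_def)
  have B: "B = region_under n g" using assms(8) by (simp add: region_under_def)
  have g: "concave_on {0..n} g" "\<And>x. x \<in> {0..n} \<Longrightarrow> g x \<ge> 0"
    using assms(5,6) by (simp_all add: less_imp_le)
  have "\<And>x. x \<in> {0..m} \<Longrightarrow> f x = t * g (x / t) + C"
    using assms(11) by (simp add: t_def mult.commute)
  then have "A = region_under (t * n) (\<lambda>x. t * g (x / t) + C)"
    unfolding assms(7) t(2) region_under_def by auto
  also have "\<dots> = (*\<^sub>R) t ` B + {0} \<times> {0..C}"
    unfolding B by (rule region_under_scaled_add_const[OF t(1) assms(10) g(2)])
  finally have A: "A = (*\<^sub>R) t ` B + {0} \<times> {0..C}" .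
  have "minkowski_sum A B = ((*\<^sub>R) t ` B + (*\<^sub>R) 1 ` B) + {0} \<times> {0..C}"
    by (simp add: minkowski_sum_eq_set_plus A ac_simps)
  also have "\<dots> = (*\<^sub>R) (t + 1) ` B + {0} \<times> {0..C}"
    unfolding B using t(1) g(1) by (simp only: scaleR_plus_scaleR_convex convex_region_under)
  finally have sum: "minkowski_sum A B = (*\<^sub>R) (t + 1) ` B + {0} \<times> {0..C}" .
  have "area A = t\<^sup>2 * area B + t * n * C"
    unfolding A area_def B using t(1) assms(2,10) g
    by (intro measure_scaled_region_under_plus_segment) auto
  moreover have "area (minkowski_sum A B) = (t + 1)\<^sup>2 * area B + (t + 1) * n * C"
    unfolding area_def sum unfolding B using t(1) assms(2,10) g
    by (intro measure_scaled_region_under_plus_segment) auto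
  ultimately show ?thesis
    unfolding t(2)[symmetric] using t(1) assms(2)
    by (simp add: field_simps power2_eq_square)
qed

end
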